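(* Let $f:\mathbb{R}^d\to\mathbb{R}$ be $L$-smooth ($L>0$) and bounded below with $f^*:=\inf_{x\in\mathbb{R}^d} f(x)>-\infty$, and suppose the stochastic gradient oracle is unbiased and satisfies the $(\rho,\sigma)$-strong growth condition, with $\rho\ge 0$ and $\sigma\ge 0$. Let $\alpha=\min\left\{\frac{\sigma}{L(1+\rho)},1\right\}$ and let $(x_t)_{t\ge1}$ be the iterates of stochastic dual averaging (SDA) with step sizes $$\eta_t=\frac{1}{L(1+\rho)\,(1+\rho+\alpha\sqrt{t})},\qquad t\ge 1.$$ Then for every integer $T\ge 1$, with $\Delta:=f(0)-f^*$, $$\frac1T\sum_{t=1}^T\mathbb{E}\left[\|\nabla f(x_t)\|^2\right]\le\left(10\,\Delta+4\left(\frac{\sigma^2}{L(1+\rho)}+L(1+\rho)\right)\log(1+\alpha\sqrt{T})\right)\frac{L(1+\rho)^2+\sigma\sqrt{T}}{T}.$$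
   Context: $\|\cdot\|$ is the Euclidean norm on $\mathbb{R}^d$. $L$-smooth: $f$ is differentiable and $f(y)\le f(x)+\langle\nabla f(x),y-x\rangle+\frac L2\|y-x\|^2$ for all $x,y\in\mathbb{R}^d$. (As usual, in the paper smoothness is also used in the form that $\nabla f$ is $L$-Lipschitz.) Stochastic gradient oracle: a query at $x\in\mathbb{R}^d$ returns a random vector $\widehat\nabla f(x)\in\mathbb{R}^d$; different queries use independent randomness. Unbiased: $\mathbb{E}[\widehat\nabla f(x)\mid x]=\nabla f(x)$ for all $x$. $(\rho,\sigma)$-strong growth condition: $\mathbb{E}\left[\|\widehat\nabla f(x)-\nabla f(x)\|^2\right]\le\rho\|\nabla f(x)\|^2+\sigma^2$ for all $x\in\mathbb{R}^d$. Along the iterates these hold conditionally on the past: with $g_t:=\widehat\nabla f(x_t)$, $\xi_t:=g_t-\nabla f(x_t)$ and $\mathcal{F}_t:=\sigma(\xi_1,\dots,\xi_{t-1})$ (so $x_t$ is $\mathcal{F}_t$-measurable), $\mathbb{E}[\xi_t\mid\mathcal{F}_t]=0$ and $\mathbb{E}[\|\xi_t\|^2\mid\mathcal{F}_t]\le\rho\|\nabla f(x_t)\|^2+\sigma^2$. SDA with step sizes $(\eta_t)_{t\ge1}$: $x_1=0$ and $x_{t+1}=-\eta_t\sum_{i=1}^t g_i$ for $t\ge1$, where $g_i=\widehat\nabla f(x_i)$. *)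

theory Defs
  imports "HOL-Probability.Probability"
begin

definition grad :: "('v::euclidean_space \<Rightarrow> real) \<Rightarrow> 'v \<Rightarrow> 'v" where
  "grad f x = (THE D. GDERIV f x :> D)"

lemma GDERIV_grad:
  fixes f :: "'v::euclidean_space \<Rightarrow> real"
  assumes "f differentiable (at x)"
  shows "GDERIV f x :> grad f x"
proof -
  from assms obtain f' where f': "(f has_derivative f') (at x)"
    by (auto simp: differentiable_def)
  interpret f': linear f'
    using f' by (rule has_derivative_linear)
  define D where "D = (\<Sum>b\<in>Basis. f' b *\<^sub>R b)"
  have "f' = (\<lambda>h. h \<bullet> D)"
    by (rule ext, subst euclidean_representation[symmetric])
      (simp add: D_def f'.sum f'.scale inner_sum_right mult.commute)
  then have D: "GDERIV f x :> D"
    using f' by (simp add: gderiv_def)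
  have "D' = D" if "GDERIV f x :> D'" for D'
    using has_derivative_unique[OF that[unfolded gderiv_def] D[unfolded gderiv_def]]
    by (metis inner_commute vector_eq_ldot)
  with D show ?thesis
    unfolding grad_def by (rule theI)
qed

(* The quadratic upper bound does not imply the Lipschitz property of the gradient for a
   nonconvex function; smoothness is understood to provide both. *)
definition L_smooth :: "real \<Rightarrow> ('v::euclidean_space \<Rightarrow> real) \<Rightarrow> bool" where
  "L_smooth L f \<longleftrightarrow>
     (\<forall>x. f differentiable (at x)) \<and>
     (\<forall>x y. f y \<le> f x + grad f x \<bullet> (y - x) + L / 2 * (norm (y - x))\<^sup>2) \<and>
     L-lipschitz_on UNIV (grad f)"

(* A stochastic gradient oracle on the probability space M is a map G: G t x w is the answer
   that the t-th query (t = 1, 2, ...) would return at the point x under the outcome w.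
   Joint measurability makes the answer at a random query point a random vector. That every
   query uses fresh randomness enters through the conditional moment bounds along the
   iterates below, which is weaker than independence of the queries. *)
definition stochastic_oracle :: "'w measure \<Rightarrow> (nat \<Rightarrow> 'v::euclidean_space \<Rightarrow> 'w \<Rightarrow> 'v) \<Rightarrow> bool" where
  "stochastic_oracle M G \<longleftrightarrow>
     (\<forall>t\<ge>1. (\<lambda>(x, w). G t x w) \<in> borel \<Otimes>\<^sub>M M \<rightarrow>\<^sub>M borel)"

definition unbiased_oracle ::
    "'w measure \<Rightarrow> ('v::euclidean_space \<Rightarrow> real) \<Rightarrow> (nat \<Rightarrow> 'v \<Rightarrow> 'w \<Rightarrow> 'v) \<Rightarrow> bool" where
  "unbiased_oracle M f G \<longleftrightarrow>
     (\<forall>t\<ge>1. \<forall>x. integrable M (G t x) \<and> (\<integral>w. G t x w \<partial>M) = grad f x)"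

definition strong_growth_oracle ::
    "'w measure \<Rightarrow> real \<Rightarrow> real \<Rightarrow> ('v::euclidean_space \<Rightarrow> real) \<Rightarrow> (nat \<Rightarrow> 'v \<Rightarrow> 'w \<Rightarrow> 'v) \<Rightarrow> bool" where
  "strong_growth_oracle M \<rho> \<sigma> f G \<longleftrightarrow>
     (\<forall>t\<ge>1. \<forall>x. (\<integral>\<^sup>+w. ennreal ((norm (G t x w - grad f x))\<^sup>2) \<partial>M)
                  \<le> ennreal (\<rho> * (norm (grad f x))\<^sup>2 + \<sigma>\<^sup>2))"

definition oracle_noise ::
    "('v::euclidean_space \<Rightarrow> real) \<Rightarrow> (nat \<Rightarrow> 'v \<Rightarrow> 'w \<Rightarrow> 'v) \<Rightarrow> (nat \<Rightarrow> 'w \<Rightarrow> 'v) \<Rightarrow> nat \<Rightarrow> 'w \<Rightarrow> 'v" where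
  "oracle_noise f G x t w = G t (x t w) w - grad f (x t w)"

(* The sigma-algebra generated by xi 1, ..., xi (t - 1); trivial for t = 1. *)
definition past_sigma :: "'w measure \<Rightarrow> (nat \<Rightarrow> 'w \<Rightarrow> 'v::euclidean_space) \<Rightarrow> nat \<Rightarrow> 'w measure" where
  "past_sigma M \<xi> t =
     sigma (space M) (\<Union>i\<in>{1..<t}. {\<xi> i -` A \<inter> space M | A. A \<in> sets borel})"

lemma subalgebra_past_sigma:
  assumes "\<And>i. 1 \<le> i \<Longrightarrow> i < t \<Longrightarrow> \<xi> i \<in> borel_measurable M"
  shows "subalgebra M (past_sigma M \<xi> t)"
proof -
  have sub: "(\<Union>i\<in>{1..<t}. {\<xi> i -` A \<inter> space M | A. A \<in> sets borel}) \<subseteq> sets M"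
    using assms by (auto intro!: measurable_sets)
  moreover have "(\<Union>i\<in>{1..<t}. {\<xi> i -` A \<inter> space M | A. A \<in> sets borel}) \<subseteq> Pow (space M)"
    by auto
  ultimately show ?thesis
    by (simp add: subalgebra_def past_sigma_def sets.sigma_sets_subset)
qed

(* E[xi_t | F_t] = 0; the library's conditional expectation is scalar, so it is taken in
   every coordinate. *)
definition conditionally_unbiased ::
    "'w measure \<Rightarrow> ('v::euclidean_space \<Rightarrow> real) \<Rightarrow> (nat \<Rightarrow> 'v \<Rightarrow> 'w \<Rightarrow> 'v) \<Rightarrow> (nat \<Rightarrow> 'w \<Rightarrow> 'v) \<Rightarrow> bool" where
  "conditionally_unbiased M f G x \<longleftrightarrow>
     (let \<xi> = oracle_noise f G x in
      \<forall>t\<ge>1. \<forall>b\<in>Basis. AE w in M.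
        real_cond_exp M (past_sigma M \<xi> t) (\<lambda>w. \<xi> t w \<bullet> b) w = 0)"

definition conditional_strong_growth ::
    "'w measure \<Rightarrow> real \<Rightarrow> real \<Rightarrow> ('v::euclidean_space \<Rightarrow> real) \<Rightarrow> (nat \<Rightarrow> 'v \<Rightarrow> 'w \<Rightarrow> 'v) \<Rightarrow>
      (nat \<Rightarrow> 'w \<Rightarrow> 'v) \<Rightarrow> bool" where
  "conditional_strong_growth M \<rho> \<sigma> f G x \<longleftrightarrow>
     (let \<xi> = oracle_noise f G x in
      \<forall>t\<ge>1. AE w in M.
        nn_cond_exp M (past_sigma M \<xi> t) (\<lambda>w. ennreal ((norm (\<xi> t w))\<^sup>2)) w
          \<le> ennreal (\<rho> * (norm (grad f (x t w)))\<^sup>2 + \<sigma>\<^sup>2))"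

(* Iterates are indexed from 1; x 0 is irrelevant. *)
definition sda_iterates ::
    "'w measure \<Rightarrow> (nat \<Rightarrow> real) \<Rightarrow> (nat \<Rightarrow> 'v::euclidean_space \<Rightarrow> 'w \<Rightarrow> 'v) \<Rightarrow> (nat \<Rightarrow> 'w \<Rightarrow> 'v) \<Rightarrow> bool" where
  "sda_iterates M \<eta> G x \<longleftrightarrow>
     (\<forall>w\<in>space M. x 1 w = 0) \<and>
     (\<forall>t\<ge>1. \<forall>w\<in>space M. x (t + 1) w = - (\<eta> t *\<^sub>R (\<Sum>i=1..t. G i (x i w) w)))"

end

theory Submission
  imports Defs
begin

text \<open>
  With \<open>K = L (1 + \<rho>)\<close> and \<open>\<Lambda> t = 1 / \<eta> t - 1 / \<eta> (t - 1) = K \<alpha> (sqrt t - sqrt (t - 1))\<close>, the SDA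
  recursion reads \<open>x (t + 1) = x t - \<eta> t (g t + \<Lambda> t x t)\<close>: it is stochastic gradient descent on the
  regularized objective \<open>f + \<Lambda> t / 2 norm^2\<close>, whose weight \<open>\<Lambda> t\<close> decreases. As \<open>x 1 = 0\<close>, the
  potential \<open>E (f (x t) + \<Lambda> (t - 1) / 2 (norm (x t))^2)\<close> starts at \<open>f 0\<close>. In each step it loses at
  least \<open>\<eta> t / 4 E (norm (grad f (x t)))^2\<close>, up to a noise term whose sum telescopes to
  a multiple of \<open>ln (1 + \<alpha> sqrt T)\<close>.
\<close>

section \<open>Deterministic estimates\<close>

lemma norm_add_square_le:
  fixes a b :: "'v::real_inner"
  shows "(norm (a + b))\<^sup>2 \<le> 2 * (norm a)\<^sup>2 + 2 * (norm b)\<^sup>2"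
proof -
  have "0 \<le> (norm (a - b))\<^sup>2"
    by simp
  then show ?thesis
    unfolding power2_norm_eq_inner
    by (simp add: inner_add_left inner_add_right inner_diff_left inner_diff_right inner_commute)
qed

text \<open>Rationalizing turns first and second differences of the square root into reciprocals of
  sums of roots. Scaled by \<alpha>, the estimate says that the regularizer weight falls fast enough
  to pay for the gradient of the regularizer.\<close>

lemma sqrt_diff_decrease:
  assumes "2 \<le> t"
  shows "(sqrt (real t) - sqrt (real t - 1))\<^sup>2
    \<le> sqrt (real t) * ((sqrt (real t - 1) - sqrt (real t - 2)) - (sqrt (real t) - sqrt (real t - 1)))"
proof -
  define p q s where "p = sqrt (real t)" and "q = sqrt (real t - 1)" and "s = sqrt (real t - 2)"
  have sq: "p\<^sup>2 = real t" "q\<^sup>2 = real t - 1" "s\<^sup>2 = real t - 2"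
    using assms by (auto simp: p_def q_def s_def)
  have ord: "0 \<le> s" "s \<le> q" "q \<le> p" "0 < q"
    using assms by (auto simp: p_def q_def s_def)
  have diff: "y - z = (y\<^sup>2 - z\<^sup>2) / (y + z)" if "0 < y + z" for y z :: real
    using that by (simp add: power2_eq_square square_diff_square_factored)
  have e1: "p - q = 1 / (p + q)" and e2: "q - s = 1 / (q + s)" and e3: "p - s = 2 / (p + s)"
    using diff[of p q] diff[of q s] diff[of p s] ord by (simp_all add: sq)
  have "(q - s) - (p - q) = (p - s) / ((q + s) * (p + q))"
    unfolding e1 e2 using ord by (simp add: diff_frac_eq)
  also have "\<dots> = 2 / ((p + s) * ((q + s) * (p + q)))"
    unfolding e3 by simp
  finally have e4: "(q - s) - (p - q) = 2 / ((p + s) * ((q + s) * (p + q)))" .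
  \<comment> \<open>By \<open>e1\<close> and \<open>e4\<close> the claim is this inequality after
    clearing denominators; the factors compare one by one because
    \<open>s \<le> q \<le> p\<close>.\<close>
  have "(p + s) * (q + s) \<le> (2 * p) * (p + q)"
    using ord by (intro mult_mono) auto
  then have "(p + s) * (q + s) * (p + q) \<le> (2 * p) * (p + q) * (p + q)"
    using ord by (intro mult_right_mono) auto
  then have "1 * ((p + s) * ((q + s) * (p + q))) \<le> (p * 2) * (p + q)\<^sup>2"
    by (simp add: power2_eq_square mult_ac)
  then have "1 / (p + q)\<^sup>2 \<le> (p * 2) / ((p + s) * ((q + s) * (p + q)))"
    using ord by (subst frac_le_eq) (auto simp: mult_ac intro!: divide_nonpos_pos)
  then have "(p - q)\<^sup>2 \<le> p * ((q - s) - (p - q))"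
    unfolding e4 by (simp add: e1 power_divide)
  then show ?thesis
    by (simp add: p_def q_def s_def)
qed

text \<open>The first and third bounds come from \<open>(p - q) * (p + q) = 1\<close>. At
  \<open>t = 1\<close> the increment is 1 and the first two bounds fail, which is why the first step
  is treated separately.\<close>

lemma sqrt_diff_bounds:
  assumes "2 \<le> t"
  shows "sqrt (real t) - sqrt (real t - 1) \<le> 1 / 2"
    and "3 * (sqrt (real t) - sqrt (real t - 1)) \<le> sqrt (real t)"
    and "(sqrt (real t) - sqrt (real t - 1)) * sqrt (real t) \<le> 1"
proof -
  define p q where "p = sqrt (real t)" and "q = sqrt (real t - 1)"
  have sq: "p\<^sup>2 = real t" "q\<^sup>2 = real t - 1"
    using assms by (auto simp: p_def q_def)
  have ord: "1 \<le> q" "q \<le> p"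
    using assms by (auto simp: p_def q_def)
  have "p\<^sup>2 - q\<^sup>2 = 1"
    by (simp only: sq)
  then have e1: "(p - q) * (p + q) = 1"
    by (simp only: power2_eq_square square_diff_square_factored mult.commute)
  have "(p - q) * 2 \<le> (p - q) * (p + q)"
    using ord by (intro mult_left_mono) auto
  then have "p - q \<le> 1 / 2"
    unfolding e1 by (subst pos_le_divide_eq) simp_all
  \<comment> \<open>In terms of \<open>t\<close> this is \<open>4 * t \<le> 9 * (t - 1)\<close>,
    true for every integer \<open>t \<ge> 2\<close>.\<close>
  moreover have "(2 * p)\<^sup>2 \<le> (3 * q)\<^sup>2"
    unfolding power_mult_distrib sq using assms by simp
  then have "2 * p \<le> 3 * q"
    using ord by (intro power2_le_imp_le[of "2 * p"]) auto
  then have "3 * (p - q) \<le> p"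
    by argo
  moreover have "(p - q) * p \<le> (p - q) * (p + q)"
    using ord by (intro mult_left_mono) auto
  then have "(p - q) * p \<le> 1"
    unfolding e1 .
  ultimately show "sqrt (real t) - sqrt (real t - 1) \<le> 1 / 2"
    and "3 * (sqrt (real t) - sqrt (real t - 1)) \<le> sqrt (real t)"
    and "(sqrt (real t) - sqrt (real t - 1)) * sqrt (real t) \<le> 1"
    by (simp_all only: p_def q_def)
qed

text \<open>Meant for \<open>u = \<alpha> * sqrt (t - 1)\<close> and
  \<open>v = \<alpha> * sqrt t\<close>. Factoring
  \<open>\<alpha>\<^sup>2 = (v - u) * (v + u)\<close> brings the left side below
  \<open>(v - u) / (1 + v)\<close>, a lower rectangle for the integral of \<open>1 / (1 + s)\<close>
  from \<open>u\<close> to \<open>v\<close>. Hence the noise terms telescope.\<close>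

lemma noise_le_log_increment:
  fixes u v \<alpha> :: real
  assumes "0 \<le> u" "u \<le> v" "v\<^sup>2 - u\<^sup>2 = \<alpha>\<^sup>2" "\<alpha>\<^sup>2 \<le> 1"
  shows "\<alpha>\<^sup>2 * ((1 + (v - u)) / (2 * (1 + v)\<^sup>2)) \<le> ln (1 + v) - ln (1 + u)"
proof -
  have cancel: "z * (2 * q) / (2 * q\<^sup>2) = z / q" if "0 < q" for q z :: real
    using that by (simp add: power2_eq_square)
  have a2: "\<alpha>\<^sup>2 = (v - u) * (v + u)"
    using assms(3) by (simp add: algebra_simps power2_eq_square)
  have "(1 + (v - u)) * (v + u) = v + u + \<alpha>\<^sup>2"
    unfolding a2 by (simp add: algebra_simps)
  also have "\<dots> \<le> 2 * (1 + v)"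
    using assms by simp
  finally have "(v - u) * ((1 + (v - u)) * (v + u)) \<le> (v - u) * (2 * (1 + v))"
    using assms by (intro mult_left_mono) auto
  then have "(v - u) * ((1 + (v - u)) * (v + u)) / (2 * (1 + v)\<^sup>2) \<le> (v - u) * (2 * (1 + v)) / (2 * (1 + v)\<^sup>2)"
    by (rule divide_right_mono) simp
  also have "\<dots> = (v - u) / (1 + v)"
    using cancel[of "1 + v" "v - u"] assms(1,2) by simp
  also have "\<dots> \<le> ln (1 + v) - ln (1 + u)"
    using ln_diff_le[of "1 + u" "1 + v"] assms(1,2) minus_divide_left[of "v - u" "1 + v"] by simp
  finally show ?thesis
    by (simp add: a2 mult_ac)
qed

text \<open>\<open>m\<close> will be \<open>(L + \<mu>) * \<eta>\<close>, the curvature of the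
  regularized objective times the step size. The first bound serves the term with the squared
  gradient of that objective, the second the term that the falling weight has to cover.\<close>

lemma regularized_step_coefficients:
  fixes r l u m :: real
  assumes "1 \<le> r" "0 \<le> l" "l \<le> 1 / 2" "3 * l \<le> u" "l * u \<le> 1"
    and m: "m = (1 / r + l) / (r + u)"
  shows "m * (2 * r - 1) \<le> 1" and "2 * u * (m * (r - 1)) \<le> r"
proof -
  have u: "0 \<le> u" and ru: "0 < r + u"
    using assms(1-5) by auto
  have k: "(1 / r) * (2 * r - 1) = r - (r - 1)\<^sup>2 / r"
    using assms(1) by (simp add: field_simps power2_eq_square)
  \<comment> \<open>By \<open>k\<close> this is what remains of the first claim. For
    \<open>r \<le> 2\<close> the factor is at most 3 and \<open>3 * l \<le> u\<close> suffices;
    otherwise \<open>2 * r - 1 = 3 + (2 * r - 4)\<close>, and the excess costs at most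
    \<open>r - 2\<close>.\<close>
  have "l * (2 * r - 1) \<le> u + (r - 1)\<^sup>2 / r"
  proof (cases "r \<le> 2")
    case True
    have "l * (2 * r - 1) \<le> l * 3"
      using True assms by (intro mult_left_mono) auto
    moreover have "0 \<le> (r - 1)\<^sup>2 / r"
      using assms(1-5) by auto
    ultimately show ?thesis
      using assms(1-5) by linarith
  next
    case False
    have "l * (2 * r - 4) \<le> 1 / 2 * (2 * r - 4)"
      using False assms by (intro mult_right_mono) auto
    moreover have "r - 2 \<le> (r - 1)\<^sup>2 / r"
      using assms(1) by (simp add: field_simps power2_eq_square)
    ultimately show ?thesis
      using assms(1-5) by (simp add: algebra_simps)
  qed
  with k have "(1 / r + l) * (2 * r - 1) \<le> r + u"
    by (simp only: distrib_right)
  then show "m * (2 * r - 1) \<le> 1"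
    using ru by (simp add: m)
  \<comment> \<open>The product \<open>l * u\<close> is isolated so that it can be replaced by 1.
    Both remaining estimates reduce to \<open>2 * (r - 1) \<le> r\<^sup>2\<close>.\<close>
  have "2 * u * ((1 / r + l) * (r - 1)) = u * (2 * (r - 1) / r) + 2 * (r - 1) * (l * u)"
    by (simp add: algebra_simps diff_divide_distrib)
  also have "\<dots> \<le> u * r + 2 * (r - 1) * 1"
  proof (intro add_mono mult_left_mono)
    have "0 \<le> (r - 1)\<^sup>2 + 1"
      by simp
    then show "2 * (r - 1) / r \<le> r"
      using assms(1) by (simp add: field_simps power2_eq_square)
  qed (use assms(1-5) u in auto)
  also have "\<dots> \<le> r * (r + u)"
    using sum_squares_ge_zero[of "r - 1" 1] by (simp add: algebra_simps)
  finally have "2 * u * ((1 / r + l) * (r - 1)) / (r + u) \<le> r"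
    using ru by (simp only: pos_divide_le_eq)
  then show "2 * u * (m * (r - 1)) \<le> r"
    by (simp add: m)
qed

text \<open>
  Here \<open>a\<close> is the gradient at \<open>x\<close>, \<open>\<mu>\<close> is the weight of the quadratic regularizer in the current
  step and \<open>D\<close> is the decrease of that weight. The decrease pays for the difference between \<open>a\<close>
  and the gradient \<open>a + \<mu> x\<close> of the regularized objective.
\<close>

lemma regularized_step_decrease:
  fixes a x :: "'v::real_inner" and r l u K L \<mu> \<eta> D :: real
  assumes "0 < K" "1 \<le> r" "0 \<le> l" "l \<le> 1 / 2" "3 * l \<le> u" "l * u \<le> 1"
    and D: "K * l\<^sup>2 \<le> u * D" "0 \<le> D"
    and L: "L = K / r" and lam: "\<mu> = K * l" and eta: "\<eta> = 1 / (K * (r + u))"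
  shows "- \<eta> * (norm (a + \<mu> *\<^sub>R x))\<^sup>2
      + (L + \<mu>) / 2 * \<eta>\<^sup>2 * ((norm (a + \<mu> *\<^sub>R x))\<^sup>2 + (r - 1) * (norm a)\<^sup>2)
      - D / 2 * (norm x)\<^sup>2 \<le> - (\<eta> / 4) * (norm a)\<^sup>2"
proof -
  define Z A X where "Z = (norm (a + \<mu> *\<^sub>R x))\<^sup>2" and "A = (norm a)\<^sup>2" and "X = (norm x)\<^sup>2"
  define m where "m = (1 / r + l) / (r + u)"
  \<comment> \<open>After division by \<eta>, \<open>B\<close> is the whole weight of
    \<open>A\<close> to be absorbed: the claimed \<open>1 / 4\<close> plus the share
    \<open>m * (r - 1) / 2\<close> from the noise that grows with the gradient.\<close>
  define B where "B = 1 / 4 + m * (r - 1) / 2"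
  have u: "0 \<le> u" and ru: "0 < r + u"
    using assms(2-6) by auto
  have m0: "0 \<le> m"
    using assms(2,3) u by (simp add: m_def)
  note c = regularized_step_coefficients[OF assms(2-6) m_def]
  have eta_pos: "0 < \<eta>"
    using assms(1) ru by (simp add: eta)
  have "L + \<mu> = K * (1 / r + l)"
    by (simp add: L lam algebra_simps)
  then have meq: "(L + \<mu>) * \<eta> = m"
    using \<open>0 < K\<close> by (simp add: m_def eta)
  have B: "0 \<le> B"
    using m0 assms(2) by (simp add: B_def)
  \<comment> \<open>Splitting \<open>a\<close> into the regularized gradient minus
    \<open>\<mu> *\<^sub>R x\<close> trades \<open>A\<close> for \<open>Z\<close> and
    \<open>X\<close>. Then \<open>p1\<close> fits the \<open>Z\<close> part into the descent term,
    and \<open>p2\<close> fits the \<open>X\<close> part into the decrease \<open>D\<close>.\<close>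
  have "A \<le> 2 * Z + 2 * (K\<^sup>2 * l\<^sup>2 * X)"
    using norm_add_square_le[of "a + \<mu> *\<^sub>R x" "- (\<mu> *\<^sub>R x)"]
    by (simp add: A_def Z_def X_def lam power_mult_distrib)
  then have "B * A \<le> B * (2 * Z + 2 * (K\<^sup>2 * l\<^sup>2 * X))"
    using B by (rule mult_left_mono)
  then have main: "B * A \<le> 2 * B * Z + 2 * B * (K\<^sup>2 * l\<^sup>2 * X)"
    by (simp add: algebra_simps)
  have "2 * (m * r) \<le> 1 + m"
    using c(1) by (simp add: algebra_simps)
  moreover have "2 * B = 1 / 2 + m * r - m"
    by (simp add: B_def field_simps)
  ultimately have "2 * B \<le> 1 - m / 2"
    by argo
  then have p1: "2 * B * Z \<le> (1 - m / 2) * Z"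
    by (intro mult_right_mono) (auto simp: Z_def)
  have "2 * B * (K * l\<^sup>2) \<le> 2 * B * (u * D)"
    using B D by (intro mult_left_mono) auto
  also have "\<dots> = (u + 2 * u * (m * (r - 1))) / 2 * D"
    by (simp add: B_def field_simps)
  also have "\<dots> \<le> (r + u) / 2 * D"
    using add_left_mono[OF c(2), of u] D(2)
    by (intro mult_right_mono divide_right_mono) (simp_all only: add.commute zero_le_numeral)
  finally have "2 * B * (K * l\<^sup>2) * (K * X) \<le> (r + u) / 2 * D * (K * X)"
    using assms(1) by (intro mult_right_mono) (auto simp: X_def)
  then have p2: "2 * B * (K\<^sup>2 * l\<^sup>2 * X) \<le> (K * (r + u)) * (D / 2 * X)"
    by (simp add: power2_eq_square algebra_simps)
  have "B * A = A / 4 + m / 2 * ((r - 1) * A)"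
    by (simp add: B_def field_simps)
  with main p1 p2 have "- Z + m / 2 * (Z + (r - 1) * A) - K * (r + u) * (D / 2 * X) \<le> - (A / 4)"
    by (simp only: distrib_left left_diff_distrib mult_1)
  then have "\<eta> * (- Z + m / 2 * (Z + (r - 1) * A) - K * (r + u) * (D / 2 * X)) \<le> \<eta> * (- (A / 4))"
    using eta_pos by (intro mult_left_mono) auto
  moreover have "\<eta> * (K * (r + u)) = 1"
    using \<open>0 < K\<close> ru by (simp add: eta)
  then have "\<eta> * (K * (r + u) * (D / 2 * X)) = D / 2 * X"
    by (simp only: mult.assoc[symmetric] mult_1)
  moreover have "(L + \<mu>) / 2 * \<eta>\<^sup>2 = \<eta> * (m / 2)"
    by (simp add: meq[symmetric] power2_eq_square)
  then have "(L + \<mu>) / 2 * \<eta>\<^sup>2 * (Z + (r - 1) * A) = \<eta> * (m / 2 * (Z + (r - 1) * A))"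
    by (simp only: mult.assoc)
  ultimately have "- \<eta> * Z + (L + \<mu>) / 2 * \<eta>\<^sup>2 * (Z + (r - 1) * A) - D / 2 * X \<le> - (\<eta> / 4) * A"
    unfolding right_diff_distrib distrib_left by linarith
  then show ?thesis
    by (simp only: Z_def A_def X_def)
qed

text \<open>At the origin the regularizer has zero gradient, so no decrease of its weight is needed;
  the increment \<alpha> may exceed \<open>1 / 2\<close> here. The coefficients only require
  \<open>1 + r * \<alpha> \<le> r + \<alpha>\<close>, which is
  \<open>0 \<le> (r - 1) * (1 - \<alpha>)\<close>.\<close>

lemma first_step_decrease:
  fixes a :: "'v::real_inner" and r \<alpha> K L \<mu> \<eta> :: real
  assumes "0 < K" "1 \<le> r" "0 \<le> \<alpha>" "\<alpha> \<le> 1"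
    and L: "L = K / r" and lam: "\<mu> = K * \<alpha>" and eta: "\<eta> = 1 / (K * (r + \<alpha>))"
  shows "- \<eta> * (norm a)\<^sup>2 + (L + \<mu>) / 2 * \<eta>\<^sup>2 * ((norm a)\<^sup>2 + (r - 1) * (norm a)\<^sup>2)
    \<le> - (\<eta> / 4) * (norm a)\<^sup>2"
proof -
  define A where "A = (norm a)\<^sup>2"
  have A: "0 \<le> A"
    by (simp add: A_def)
  have eta_pos: "0 < \<eta>"
    using assms(1-4) by (simp add: eta)
  have "0 \<le> (r - 1) * (1 - \<alpha>)"
    using assms(2,4) by (intro mult_nonneg_nonneg) auto
  then have "1 + r * \<alpha> \<le> r + \<alpha>"
    by (simp add: algebra_simps)
  moreover have "L + \<mu> = K * (1 / r + \<alpha>)"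
    by (simp add: L lam algebra_simps)
  then have "(L + \<mu>) * \<eta> * r = (1 + r * \<alpha>) / (r + \<alpha>)"
    using assms(1,2) by (simp add: eta) (simp add: field_simps)
  ultimately have "(L + \<mu>) * \<eta> * r \<le> 1"
    using assms(2,3) by simp
  then have "\<eta> * ((L + \<mu>) * \<eta> * r * A) \<le> \<eta> * (1 * A)"
    using A eta_pos by (intro mult_left_mono mult_right_mono) auto
  moreover have "(L + \<mu>) / 2 * \<eta>\<^sup>2 * (A + (r - 1) * A) = \<eta> * ((L + \<mu>) * \<eta> * r * A) / 2"
    by (simp only: power2_eq_square left_diff_distrib) simp
  moreover have "0 \<le> \<eta> * A"
    using A eta_pos by simp
  ultimately have "- \<eta> * A + (L + \<mu>) / 2 * \<eta>\<^sup>2 * (A + (r - 1) * A) \<le> - (\<eta> / 4) * A"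
    by linarith
  then show ?thesis
    by (simp only: A_def)
qed

text \<open>The left side is the variance contribution
  \<open>(L + \<mu>) / 2 * \<eta>\<^sup>2 * \<sigma>\<^sup>2\<close> of one step. For fixed
  \<open>K\<close> it is largest at \<open>r = 1\<close>, where the logarithmic increment
  applies.\<close>

lemma noise_term_le:
  fixes K r u v \<alpha> \<sigma> :: real
  assumes "0 < K" "1 \<le> r" "0 \<le> \<sigma>" and \<alpha>: "\<alpha> = min (\<sigma> / K) 1"
    and uv: "0 \<le> u" "u \<le> v" "v\<^sup>2 - u\<^sup>2 = \<alpha>\<^sup>2"
  shows "(K / r + K * (v - u)) / 2 * (1 / (K * (r + v)))\<^sup>2 * \<sigma>\<^sup>2
    \<le> (\<sigma>\<^sup>2 / K + K) * (ln (1 + v) - ln (1 + u))"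
proof -
  define Y where "Y = (1 + (v - u)) / (2 * (1 + v)\<^sup>2)"
  have \<alpha>01: "0 \<le> \<alpha>" "\<alpha> \<le> 1"
    using assms(1,3) by (auto simp: \<alpha>)
  have Y: "0 \<le> Y"
    using uv by (simp add: Y_def)
  \<comment> \<open>Each branch of the minimum yields one summand: either
    \<open>\<sigma> = \<alpha> * K\<close> or \<open>\<alpha> = 1\<close>.\<close>
  have "\<sigma>\<^sup>2 \<le> \<alpha>\<^sup>2 * (\<sigma>\<^sup>2 + K\<^sup>2)"
  proof (cases "\<sigma> / K \<le> 1")
    case True
    then have "\<sigma> = \<alpha> * K"
      using assms(1) by (simp add: \<alpha>)
    then have "\<sigma>\<^sup>2 = \<alpha>\<^sup>2 * K\<^sup>2"
      by (simp add: power_mult_distrib)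
    also have "\<dots> \<le> \<alpha>\<^sup>2 * (\<sigma>\<^sup>2 + K\<^sup>2)"
      by (intro mult_left_mono) auto
    finally show ?thesis .
  next
    case False
    then show ?thesis
      by (simp add: \<alpha>)
  qed
  then have "\<sigma>\<^sup>2 / K \<le> \<alpha>\<^sup>2 * (\<sigma>\<^sup>2 + K\<^sup>2) / K"
    using assms(1) by (intro divide_right_mono) auto
  also have "\<dots> = \<alpha>\<^sup>2 * (\<sigma>\<^sup>2 / K + K)"
    using assms(1) by (simp add: field_simps power2_eq_square)
  finally have \<sigma>: "\<sigma>\<^sup>2 / K \<le> \<alpha>\<^sup>2 * (\<sigma>\<^sup>2 / K + K)" .
  have "(K / r + K * (v - u)) / 2 * (1 / (K * (r + v)))\<^sup>2 * \<sigma>\<^sup>2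
    = K * (1 / r + (v - u)) / 2 * (1 / (K * (r + v)))\<^sup>2 * \<sigma>\<^sup>2"
    by (simp add: distrib_left)
  also have "\<dots> = \<sigma>\<^sup>2 / K * ((1 / r + (v - u)) / (2 * (r + v)\<^sup>2))"
    using assms(1) by (simp add: power2_eq_square mult_ac)
  also have "\<dots> \<le> \<sigma>\<^sup>2 / K * Y"
    unfolding Y_def using assms(1,2) uv
    by (intro mult_left_mono frac_le add_mono power_mono mult_pos_pos) auto
  also have "\<dots> \<le> \<alpha>\<^sup>2 * (\<sigma>\<^sup>2 / K + K) * Y"
    using \<sigma> Y by (rule mult_right_mono)
  also have "\<dots> = (\<sigma>\<^sup>2 / K + K) * (\<alpha>\<^sup>2 * Y)"
    by (simp only: mult_ac)
  also have "\<dots> \<le> (\<sigma>\<^sup>2 / K + K) * (ln (1 + v) - ln (1 + u))"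
    unfolding Y_def using assms(1) uv \<alpha>01
    by (intro mult_left_mono noise_le_log_increment) (auto simp: power_le_one)
  finally show ?thesis .
qed

section \<open>Square integrable random vectors\<close>

text \<open>Membership in L^2 for vectors. Measurability is a separate conjunct because a measurable
  squared norm does not make the vector itself measurable.\<close>

definition square_integrable :: "'w measure \<Rightarrow> ('w \<Rightarrow> 'v::euclidean_space) \<Rightarrow> bool" where
  "square_integrable M a \<longleftrightarrow> a \<in> borel_measurable M \<and> integrable M (\<lambda>w. (norm (a w))\<^sup>2)"

lemma square_integrableD:
  assumes "square_integrable M a"
  shows "a \<in> borel_measurable M" "integrable M (\<lambda>w. (norm (a w))\<^sup>2)"
  using assms by (auto simp: square_integrable_def)

lemma square_integrable_scaleR:
  "square_integrable M a \<Longrightarrow> square_integrable M (\<lambda>w. c *\<^sub>R a w)"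
  by (auto simp: square_integrable_def power_mult_distrib)

lemma square_integrable_add:
  assumes a: "square_integrable M a" and b: "square_integrable M b"
  shows "square_integrable M (\<lambda>w. a w + b w)"
proof -
  note [measurable] = square_integrableD(1)[OF a] square_integrableD(1)[OF b]
  have "integrable M (\<lambda>w. 2 * (norm (a w))\<^sup>2 + 2 * (norm (b w))\<^sup>2)"
    using a b by (auto simp: square_integrable_def)
  then have "integrable M (\<lambda>w. (norm (a w + b w))\<^sup>2)"
    by (rule Bochner_Integration.integrable_bound) (auto simp: norm_add_square_le)
  then show ?thesis
    by (simp add: square_integrable_def)
qed

lemma square_integrable_zero: "square_integrable M (\<lambda>w. 0)"
  by (simp add: square_integrable_def)

lemma square_integrable_sum:
  assumes "\<And>i. i \<in> I \<Longrightarrow> square_integrable M (a i)"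
  shows "square_integrable M (\<lambda>w. \<Sum>i\<in>I. a i w)"
  using assms
  by (induction I rule: infinite_finite_induct)
    (auto intro: square_integrable_add square_integrable_zero)

lemma square_integrable_cong:
  assumes "\<And>w. w \<in> space M \<Longrightarrow> a w = b w"
  shows "square_integrable M a \<longleftrightarrow> square_integrable M b"
proof -
  have "a \<in> borel_measurable M \<longleftrightarrow> b \<in> borel_measurable M"
    using assms by (rule measurable_cong)
  moreover have "integrable M (\<lambda>w. (norm (a w))\<^sup>2) \<longleftrightarrow> integrable M (\<lambda>w. (norm (b w))\<^sup>2)"
    using assms by (intro Bochner_Integration.integrable_cong) auto
  ultimately show ?thesis
    by (simp add: square_integrable_def)
qed

lemma integrable_inner:
  assumes a: "square_integrable M a" and b: "square_integrable M b"
  shows "integrable M (\<lambda>w. a w \<bullet> b w)"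
proof -
  note [measurable] = square_integrableD(1)[OF a] square_integrableD(1)[OF b]
  have "integrable M (\<lambda>w. (norm (a w))\<^sup>2 + (norm (b w))\<^sup>2)"
    using a b by (auto simp: square_integrable_def)
  then show ?thesis
  proof (rule Bochner_Integration.integrable_bound)
    have "\<bar>u \<bullet> v\<bar> \<le> (norm u)\<^sup>2 + (norm v)\<^sup>2" for u v :: 'b
    proof -
      have "2 * (norm u * norm v) \<le> (norm u)\<^sup>2 + (norm v)\<^sup>2"
        using sum_squares_bound[of "norm u" "norm v"] by simp
      moreover have "0 \<le> norm u * norm v"
        by simp
      ultimately show ?thesis
        using Cauchy_Schwarz_ineq2[of u v] by linarith
    qed
    then show "AE w in M. norm (a w \<bullet> b w) \<le> norm ((norm (a w))\<^sup>2 + (norm (b w))\<^sup>2)"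
      by simp
  qed simp
qed

text \<open>In each coordinate the \<open>F\<close>-measurable factor can be integrated against the
  conditional expectation instead, which vanishes; the inner product is the sum over the
  coordinates.\<close>

lemma (in sigma_finite_subalgebra) integral_inner_eq_0_if_cond_exp_eq_0:
  fixes \<xi> h :: "'a \<Rightarrow> 'v::euclidean_space"
  assumes \<xi>: "square_integrable M \<xi>" and h: "square_integrable M h" "h \<in> borel_measurable F"
    and zero: "\<And>b. b \<in> Basis \<Longrightarrow> AE w in M. real_cond_exp M F (\<lambda>w. \<xi> w \<bullet> b) w = 0"
  shows "(\<integral>w. \<xi> w \<bullet> h w \<partial>M) = 0"
proof -
  note [measurable] = square_integrableD(1)[OF \<xi>] square_integrableD(1)[OF h(1)] h(2)
  have int: "integrable M (\<lambda>w. (h w \<bullet> b) * (\<xi> w \<bullet> b))" if "b \<in> Basis" for b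
  proof -
    \<comment> \<open>The product of coordinates is the inner product of \<open>h\<close> with the
      projection of \<xi> onto \<open>b\<close>, so \<open>integrable_inner\<close> applies.\<close>
    have "square_integrable M (\<lambda>w. (\<xi> w \<bullet> b) *\<^sub>R b)"
      unfolding square_integrable_def
    proof
      show "integrable M (\<lambda>w. (norm ((\<xi> w \<bullet> b) *\<^sub>R b))\<^sup>2)"
      proof (rule Bochner_Integration.integrable_bound[OF square_integrableD(2)[OF \<xi>]])
        have "(\<xi> w \<bullet> b)\<^sup>2 \<le> (norm (\<xi> w))\<^sup>2" for w
          using power_mono[OF Basis_le_norm[OF that, of "\<xi> w"], of 2] by simp
        then show "AE w in M. norm ((norm ((\<xi> w \<bullet> b) *\<^sub>R b))\<^sup>2) \<le> norm ((norm (\<xi> w))\<^sup>2)"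
          using that by simp
      qed simp
    qed simp
    from integrable_inner[OF h(1) this] show ?thesis
      by (simp add: mult.commute)
  qed
  have "(\<integral>w. (h w \<bullet> b) * (\<xi> w \<bullet> b) \<partial>M) = 0" if b: "b \<in> Basis" for b
  proof -
    have "(\<integral>w. (h w \<bullet> b) * (\<xi> w \<bullet> b) \<partial>M)
      = (\<integral>w. (h w \<bullet> b) * real_cond_exp M F (\<lambda>w. \<xi> w \<bullet> b) w \<partial>M)"
      by (rule real_cond_exp_intg(2)[symmetric]) (use int[OF b] in auto)
    also have "\<dots> = (\<integral>w. 0 \<partial>M)"
      using zero[OF b] by (intro integral_cong_AE) auto
    finally show ?thesis
      by simp
  qed
  moreover have "(\<integral>w. \<xi> w \<bullet> h w \<partial>M) = (\<Sum>b\<in>Basis. \<integral>w. (h w \<bullet> b) * (\<xi> w \<bullet> b) \<partial>M)"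
    using int by (subst Bochner_Integration.integral_sum[symmetric])
      (auto simp: euclidean_inner[of "\<xi> _" "h _"] mult.commute)
  ultimately show ?thesis
    by simp
qed

text \<open>The nonnegative conditional expectation needs no prior integrability. Integrating it
  against the constant 1 therefore delivers finiteness of the second moment as a conclusion.\<close>

lemma (in sigma_finite_subalgebra) second_moment_le_if_cond_exp_le:
  fixes \<xi> :: "'a \<Rightarrow> 'v::euclidean_space" and q :: "'a \<Rightarrow> real"
  assumes \<xi>[measurable]: "\<xi> \<in> borel_measurable M" and q: "integrable M q" "\<And>w. 0 \<le> q w"
    and le: "AE w in M. nn_cond_exp M F (\<lambda>w. ennreal ((norm (\<xi> w))\<^sup>2)) w \<le> ennreal (q w)"
  shows "square_integrable M \<xi>" and "(\<integral>w. (norm (\<xi> w))\<^sup>2 \<partial>M) \<le> (\<integral>w. q w \<partial>M)"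
proof -
  have "(\<integral>\<^sup>+w. ennreal ((norm (\<xi> w))\<^sup>2) \<partial>M)
      = (\<integral>\<^sup>+w. nn_cond_exp M F (\<lambda>w. ennreal ((norm (\<xi> w))\<^sup>2)) w \<partial>M)"
    using nn_cond_exp_intg[of "\<lambda>_. 1" "\<lambda>w. ennreal ((norm (\<xi> w))\<^sup>2)"] by simp
  also have "\<dots> \<le> (\<integral>\<^sup>+w. ennreal (q w) \<partial>M)"
    using le by (rule nn_integral_mono_AE)
  also have "\<dots> = ennreal (\<integral>w. q w \<partial>M)"
    using q by (intro nn_integral_eq_integral) auto
  finally have nn: "(\<integral>\<^sup>+w. ennreal ((norm (\<xi> w))\<^sup>2) \<partial>M) \<le> ennreal (\<integral>w. q w \<partial>M)" .
  then have "(\<integral>\<^sup>+w. ennreal (norm ((norm (\<xi> w))\<^sup>2)) \<partial>M) < \<infinity>"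
    by (simp add: order_le_less_trans[OF _ ennreal_less_top])
  then have int: "integrable M (\<lambda>w. (norm (\<xi> w))\<^sup>2)"
    by (intro integrableI_bounded) auto
  then show "square_integrable M \<xi>"
    by (simp add: square_integrable_def)
  show "(\<integral>w. (norm (\<xi> w))\<^sup>2 \<partial>M) \<le> (\<integral>w. q w \<partial>M)"
    using nn nn_integral_eq_integral[OF int] q by (simp add: integral_nonneg_AE)
qed

section \<open>Expected descent along the iterates\<close>

lemma space_past_sigma [simp]: "space (past_sigma M \<xi> t) = space M"
  unfolding past_sigma_def by (rule space_measure_of) auto

lemma sets_past_sigma:
  "sets (past_sigma M \<xi> t) =
    sigma_sets (space M) (\<Union>i\<in>{1..<t}. {\<xi> i -` A \<inter> space M | A. A \<in> sets borel})"
  unfolding past_sigma_def by (rule sets_measure_of) auto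

lemma measurable_past_sigma:
  assumes "1 \<le> i" "i < t"
  shows "\<xi> i \<in> borel_measurable (past_sigma M \<xi> t)"
proof (rule measurableI)
  fix A :: "'b set" assume "A \<in> sets borel"
  then have "\<xi> i -` A \<inter> space M \<in> (\<Union>i\<in>{1..<t}. {\<xi> i -` A \<inter> space M | A. A \<in> sets borel})"
    using assms by (intro UN_I[of i]) auto
  then show "\<xi> i -` A \<inter> space (past_sigma M \<xi> t) \<in> sets (past_sigma M \<xi> t)"
    unfolding sets_past_sigma space_past_sigma by (rule sigma_sets.Basic)
qed simp

lemma measurable_past_sigma_mono:
  assumes "s \<le> t" "h \<in> borel_measurable (past_sigma M \<xi> s)"
  shows "h \<in> borel_measurable (past_sigma M \<xi> t)"
proof -
  have "sets (past_sigma M \<xi> s) \<subseteq> sets (past_sigma M \<xi> t)"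
    unfolding sets_past_sigma using assms(1) by (intro sigma_sets_mono') fastforce
  then have "subalgebra (past_sigma M \<xi> t) (past_sigma M \<xi> s)"
    by (simp add: subalgebra_def)
  from measurable_from_subalg[OF this assms(2)] show ?thesis .
qed

text \<open>The quadratic regularizer expands exactly, so its linear term turns
  \<open>grad f x\<close> into \<open>z\<close> and its curvature adds to \<open>L\<close>. The term
  linear in \<xi> is kept apart because it vanishes in expectation.\<close>

lemma L_smooth_descent:
  fixes x \<xi> :: "'v::euclidean_space" and \<mu> e :: real
  assumes "L_smooth L f"
  defines "z \<equiv> grad f x + \<mu> *\<^sub>R x"
  shows "f (x - e *\<^sub>R (z + \<xi>)) + \<mu> / 2 * (norm (x - e *\<^sub>R (z + \<xi>)))\<^sup>2
    \<le> f x + \<mu> / 2 * (norm x)\<^sup>2 - e * (norm z)\<^sup>2 + (L + \<mu>) / 2 * e\<^sup>2 * ((norm z)\<^sup>2 + (norm \<xi>)\<^sup>2)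
      + ((L + \<mu>) * e\<^sup>2 - e) * (\<xi> \<bullet> z)"
proof -
  define y where "y = x - e *\<^sub>R (z + \<xi>)"
  have "f y \<le> f x + grad f x \<bullet> (y - x) + L / 2 * (norm (y - x))\<^sup>2"
    using assms(1) unfolding L_smooth_def by blast
  then have "f y + \<mu> / 2 * (norm y)\<^sup>2
    \<le> f x + grad f x \<bullet> (y - x) + L / 2 * (norm (y - x))\<^sup>2 + \<mu> / 2 * (norm y)\<^sup>2"
    by simp
  also have "grad f x = z - \<mu> *\<^sub>R x"
    by (simp add: z_def)
  also have "f x + (z - \<mu> *\<^sub>R x) \<bullet> (y - x) + L / 2 * (norm (y - x))\<^sup>2 + \<mu> / 2 * (norm y)\<^sup>2
    = f x + \<mu> / 2 * (norm x)\<^sup>2 + z \<bullet> (y - x) + (L + \<mu>) / 2 * (norm (y - x))\<^sup>2"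
    unfolding power2_norm_eq_inner
    by (simp add: inner_diff_left inner_diff_right inner_commute field_simps)
  also have "y - x = - (e *\<^sub>R (z + \<xi>))"
    by (simp add: y_def)
  also have "(norm (- (e *\<^sub>R (z + \<xi>))))\<^sup>2 = e\<^sup>2 * ((norm z)\<^sup>2 + 2 * (\<xi> \<bullet> z) + (norm \<xi>)\<^sup>2)"
    unfolding power2_norm_eq_inner
    by (simp add: inner_add_left inner_add_right inner_commute power2_eq_square algebra_simps)
  also have "z \<bullet> - (e *\<^sub>R (z + \<xi>)) = - e * (norm z)\<^sup>2 - e * (\<xi> \<bullet> z)"
    unfolding power2_norm_eq_inner
    by (simp add: inner_add_right inner_commute algebra_simps)
  finally show ?thesis
    unfolding y_def by (simp add: field_simps)
qed


lemma L_smooth_continuous: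
  assumes "L_smooth L f"
  shows "continuous_on UNIV (grad f)" "continuous_on UNIV f"
proof -
  have "L-lipschitz_on UNIV (grad f)"
    using assms by (simp add: L_smooth_def)
  then show "continuous_on UNIV (grad f)"
    by (rule lipschitz_on_continuous_on)
  show "continuous_on UNIV f"
    using assms by (auto simp: L_smooth_def continuous_on_eq_continuous_at
        intro: differentiable_imp_continuous_within)
qed

text \<open>The step sizes stay arbitrary: integrability and the expected step inequality are
  obtained independently of the schedule.\<close>

locale sda_process = prob_space M for M :: "'w measure" +
  fixes f :: "'v::euclidean_space \<Rightarrow> real"
    and G :: "nat \<Rightarrow> 'v \<Rightarrow> 'w \<Rightarrow> 'v"
    and x :: "nat \<Rightarrow> 'w \<Rightarrow> 'v"
    and \<eta> :: "nat \<Rightarrow> real"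
    and L \<rho> \<sigma> :: real
  assumes L_pos: "0 < L" and smooth: "L_smooth L f" and bdd: "bdd_below (range f)"
    and rho: "0 \<le> \<rho>"
    and queries: "stochastic_oracle M G"
    and iterates: "sda_iterates M \<eta> G x"
    and unbiased: "conditionally_unbiased M f G x"
    and growth: "conditional_strong_growth M \<rho> \<sigma> f G x"
begin

section \<open>Measurability and second moments along the iterates\<close>

definition "\<xi> = oracle_noise f G x"

definition "\<F> = past_sigma M \<xi>"

lemma oracle_eq: "G t (x t w) w = grad f (x t w) + \<xi> t w"
  by (simp add: \<xi>_def oracle_noise_def)

lemma iterate_1: "w \<in> space M \<Longrightarrow> x 1 w = 0"
  using iterates by (simp add: sda_iterates_def)

lemma iterate_Suc:
  assumes "1 \<le> t" "w \<in> space M"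
  shows "x (t + 1) w = - (\<eta> t *\<^sub>R (\<Sum>i=1..t. grad f (x i w) + \<xi> i w))"
  using iterates assms by (simp add: sda_iterates_def flip: oracle_eq)

lemma grad_measurable [measurable]: "grad f \<in> borel_measurable borel"
  using L_smooth_continuous(1)[OF smooth] by (rule borel_measurable_continuous_onI)

lemma f_measurable [measurable]: "f \<in> borel_measurable borel"
  using L_smooth_continuous(2)[OF smooth] by (rule borel_measurable_continuous_onI)

text \<open>The two claims need each other: \<open>x t\<close> is a function of earlier iterates and
  noise, and measurability of the earlier noise makes \<open>\<F> t\<close> a subalgebra, through
  which \<open>x t\<close> and then \<open>\<xi> t\<close> become measurable on
  \<open>M\<close>.\<close>

lemma measurable_iterate_noise:
  "1 \<le> t \<Longrightarrow> x t \<in> borel_measurable (\<F> t) \<and> \<xi> t \<in> borel_measurable M"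
proof (induction t rule: less_induct)
  case (less t)
  have sub: "subalgebra M (\<F> t)"
    unfolding \<F>_def using less.IH by (intro subalgebra_past_sigma) auto
  have x: "x t \<in> borel_measurable (\<F> t)"
  proof (cases "t = 1")
    case True
    then have "x t \<in> borel_measurable (\<F> t) \<longleftrightarrow> (\<lambda>_. 0 :: 'v) \<in> borel_measurable (\<F> t)"
      by (intro measurable_cong) (simp add: \<F>_def iterate_1[simplified])
    then show ?thesis
      by simp
  next
    case False
    then obtain n where n: "t = n + 1" "1 \<le> n"
      using less.prems by (metis Suc_eq_plus1 Suc_le_D le_antisym not_less_eq_eq One_nat_def)
    have "x i \<in> borel_measurable (\<F> t)" if "i \<in> {1..n}" for i
      using less.IH[of i] that n unfolding \<F>_def
      by (intro measurable_past_sigma_mono[of i t]) auto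
    then have [measurable]: "(\<lambda>w. grad f (x i w)) \<in> borel_measurable (\<F> t)" if "i \<in> {1..n}" for i
      using that by measurable
    have [measurable]: "\<xi> i \<in> borel_measurable (\<F> t)" if "i \<in> {1..n}" for i
      unfolding \<F>_def using that n by (intro measurable_past_sigma) auto
    have "x t \<in> borel_measurable (\<F> t) \<longleftrightarrow>
      (\<lambda>w. - (\<eta> n *\<^sub>R (\<Sum>i=1..n. grad f (x i w) + \<xi> i w))) \<in> borel_measurable (\<F> t)"
      using iterate_Suc[OF n(2)] n by (intro measurable_cong) (simp add: \<F>_def)
    then show ?thesis
      by simp
  qed
  have xM [measurable]: "x t \<in> borel_measurable M"
    by (rule measurable_from_subalg[OF sub x])
  have G [measurable]: "(\<lambda>(x, w). G t x w) \<in> borel \<Otimes>\<^sub>M M \<rightarrow>\<^sub>M borel"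
    using queries less.prems by (simp add: stochastic_oracle_def)
  \<comment> \<open>Joint measurability of the oracle permits evaluating it at a random
    point.\<close>
  have "(\<lambda>w. (\<lambda>(x, w). G t x w) (x t w, w)) \<in> borel_measurable M"
    by measurable
  then have "\<xi> t \<in> borel_measurable M"
    unfolding \<xi>_def oracle_noise_def by simp
  with x show ?case
    by blast
qed

lemma subalgebra_past: "subalgebra M (\<F> t)"
  unfolding \<F>_def using measurable_iterate_noise by (intro subalgebra_past_sigma) auto

lemma finite_measure_subalgebra_past: "finite_measure_subalgebra M (\<F> t)"
  using subalgebra_past by unfold_locales

lemma grad_square_integrable:
  assumes "square_integrable M y"
  shows "square_integrable M (\<lambda>w. grad f (y w))"
proof -
  note [measurable] = square_integrableD(1)[OF assms]
  have bound: "(norm (grad f v))\<^sup>2 \<le> 2 * (norm (grad f 0))\<^sup>2 + 2 * (L\<^sup>2 * (norm v)\<^sup>2)" for v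
  proof -
    have "L-lipschitz_on UNIV (grad f)"
      using smooth by (simp add: L_smooth_def)
    then have "norm (grad f v - grad f 0) \<le> L * norm v"
      using lipschitz_onD[of L UNIV "grad f" v 0] by (simp add: dist_norm)
    then have "(norm (grad f v - grad f 0))\<^sup>2 \<le> L\<^sup>2 * (norm v)\<^sup>2"
      by (metis norm_ge_zero power_mono power_mult_distrib)
    with norm_add_square_le[of "grad f 0" "grad f v - grad f 0"] show ?thesis
      by simp
  qed
  have "integrable M (\<lambda>w. 2 * (norm (grad f 0))\<^sup>2 + 2 * (L\<^sup>2 * (norm (y w))\<^sup>2))"
    using square_integrableD(2)[OF assms] by simp
  then have "integrable M (\<lambda>w. (norm (grad f (y w)))\<^sup>2)"
    by (rule Bochner_Integration.integrable_bound) (auto simp: bound)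
  then show ?thesis
    by (simp add: square_integrable_def)
qed

lemma noise_second_moment:
  assumes t: "1 \<le> t" and x: "square_integrable M (x t)"
  shows "square_integrable M (\<xi> t)"
    and "(\<integral>w. (norm (\<xi> t w))\<^sup>2 \<partial>M) \<le> \<rho> * (\<integral>w. (norm (grad f (x t w)))\<^sup>2 \<partial>M) + \<sigma>\<^sup>2"
proof -
  interpret past: finite_measure_subalgebra M "\<F> t"
    by (rule finite_measure_subalgebra_past)
  note grad = square_integrableD(2)[OF grad_square_integrable[OF x]]
  have \<xi>: "\<xi> t \<in> borel_measurable M"
    using measurable_iterate_noise t by blast
  have int: "integrable M (\<lambda>w. \<rho> * (norm (grad f (x t w)))\<^sup>2 + \<sigma>\<^sup>2)"
    using grad by simp
  have le: "AE w in M. nn_cond_exp M (\<F> t) (\<lambda>w. ennreal ((norm (\<xi> t w))\<^sup>2)) w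
      \<le> ennreal (\<rho> * (norm (grad f (x t w)))\<^sup>2 + \<sigma>\<^sup>2)"
    using growth t unfolding conditional_strong_growth_def \<F>_def \<xi>_def Let_def by blast
  have nonneg: "0 \<le> \<rho> * (norm (grad f (x t w)))\<^sup>2 + \<sigma>\<^sup>2" for w
    using rho by simp
  note bounds = past.second_moment_le_if_cond_exp_le[OF \<xi> int nonneg le]
  show "square_integrable M (\<xi> t)"
    by (rule bounds(1))
  show "(\<integral>w. (norm (\<xi> t w))\<^sup>2 \<partial>M) \<le> \<rho> * (\<integral>w. (norm (grad f (x t w)))\<^sup>2 \<partial>M) + \<sigma>\<^sup>2"
    using bounds(2) grad by (simp add: prob_space)
qed

text \<open>The Lipschitz gradient grows at most linearly, and the growth condition bounds the noise
  by the gradient. Each new iterate is a finite combination of such terms, so square integrability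
  propagates.\<close>

lemma iterate_square_integrable: "1 \<le> t \<Longrightarrow> square_integrable M (x t)"
proof (induction t rule: less_induct)
  case (less t)
  show ?case
  proof (cases "t = 1")
    case True
    with square_integrable_cong[of M "x t" "\<lambda>_. 0"] iterate_1 show ?thesis
      by (simp add: square_integrable_zero)
  next
    case False
    then obtain n where n: "t = n + 1" "1 \<le> n"
      using less.prems by (metis Suc_eq_plus1 Suc_le_D le_antisym not_less_eq_eq One_nat_def)
    have "square_integrable M (\<lambda>w. grad f (x i w) + \<xi> i w)" if "i \<in> {1..n}" for i
      using less.IH[of i] that n
      by (intro square_integrable_add grad_square_integrable noise_second_moment(1)) auto
    then have "square_integrable M (\<lambda>w. (- \<eta> n) *\<^sub>R (\<Sum>i=1..n. grad f (x i w) + \<xi> i w))"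
      by (intro square_integrable_scaleR square_integrable_sum) auto
    with square_integrable_cong[of M "x t"
        "\<lambda>w. (- \<eta> n) *\<^sub>R (\<Sum>i=1..n. grad f (x i w) + \<xi> i w)"] iterate_Suc[OF n(2)] n
    show ?thesis
      by simp
  qed
qed

lemma noise_orthogonal:
  assumes t: "1 \<le> t" and h: "square_integrable M h" "h \<in> borel_measurable (\<F> t)"
  shows "(\<integral>w. \<xi> t w \<bullet> h w \<partial>M) = 0"
proof -
  interpret past: finite_measure_subalgebra M "\<F> t"
    by (rule finite_measure_subalgebra_past)
  show ?thesis
  proof (rule past.integral_inner_eq_0_if_cond_exp_eq_0)
    show "square_integrable M (\<xi> t)"
      using t by (intro noise_second_moment iterate_square_integrable)
    show "AE w in M. real_cond_exp M (\<F> t) (\<lambda>w. \<xi> t w \<bullet> b) w = 0" if "b \<in> Basis" for b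
      using unbiased t that unfolding conditionally_unbiased_def \<F>_def \<xi>_def Let_def by blast
  qed (use h in auto)
qed

text \<open>\<open>f\<close> lies between a constant and the quadratic given by smoothness at the
  origin.\<close>

lemma f_integrable:
  assumes "square_integrable M y"
  shows "integrable M (\<lambda>w. f (y w))"
proof -
  note [measurable] = square_integrableD(1)[OF assms]
  obtain m where m: "\<And>v. m \<le> f v"
    using bdd by (auto simp: bdd_below_def)
  let ?c = "grad f 0"
  have bound: "\<bar>f v\<bar> \<le> \<bar>m\<bar> + \<bar>f 0\<bar> + (norm ?c)\<^sup>2 + (1 + L / 2) * (norm v)\<^sup>2" for v
  proof -
    have "f v \<le> f 0 + ?c \<bullet> v + L / 2 * (norm v)\<^sup>2"
      using smooth unfolding L_smooth_def by (metis diff_zero)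
    \<comment> \<open>Expanding the first square absorbs the linear term
      \<open>?c \<bullet> v\<close> into squared norms.\<close>
    moreover have "0 \<le> (norm (?c - v))\<^sup>2" "0 \<le> (norm ?c)\<^sup>2" "0 \<le> (norm v)\<^sup>2" "0 \<le> L / 2 * (norm v)\<^sup>2"
      using L_pos by auto
    moreover have "(norm (?c - v))\<^sup>2 = (norm ?c)\<^sup>2 - 2 * (?c \<bullet> v) + (norm v)\<^sup>2"
      unfolding power2_norm_eq_inner by (simp add: inner_diff_left inner_diff_right inner_commute)
    moreover have "(1 + L / 2) * (norm v)\<^sup>2 = (norm v)\<^sup>2 + L / 2 * (norm v)\<^sup>2"
      by (simp add: distrib_right)
    ultimately show ?thesis
      using m[of v] by linarith
  qed
  have "integrable M (\<lambda>w. \<bar>m\<bar> + \<bar>f 0\<bar> + (norm ?c)\<^sup>2 + (1 + L / 2) * (norm (y w))\<^sup>2)"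
    using square_integrableD(2)[OF assms] by simp
  then show ?thesis
    by (rule Bochner_Integration.integrable_bound) (auto intro!: AE_I2 order_trans[OF bound])
qed

section \<open>The regularized recursion and its expected decrease\<close>

lemma iterate_regularized_step:
  assumes t: "1 \<le> t" and w: "w \<in> space M"
    and rec: "2 \<le> t \<Longrightarrow> \<eta> t = (1 - \<eta> t * c) * \<eta> (t - 1)"
  shows "x (t + 1) w = x t w - \<eta> t *\<^sub>R ((grad f (x t w) + c *\<^sub>R x t w) + \<xi> t w)"
proof (cases "t = 1")
  \<comment> \<open>As \<open>x 1 = 0\<close>, any weight \<open>c\<close> gives the same first
    step.\<close>
  case True
  with iterate_Suc[OF t w] iterate_1[OF w] show ?thesis
    by simp
next
  case False
  then obtain n where n: "t = n + 1" "1 \<le> n"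
    using t by (metis Suc_eq_plus1 Suc_le_D le_antisym not_less_eq_eq One_nat_def)
  define S where "S = (\<Sum>i=1..n. grad f (x i w) + \<xi> i w)"
  have x: "x t w = - (\<eta> n *\<^sub>R S)"
    using iterate_Suc[OF n(2) w] by (simp add: n S_def)
  \<comment> \<open>For nonzero step sizes this is
    \<open>1 / \<eta> t - 1 / \<eta> (t - 1) = c\<close> cleared of divisions. It rescales the old
    sum \<open>S\<close> from \<open>\<eta> n\<close> to \<open>\<eta> t\<close>, which shrinks
    \<open>x t\<close> by the factor \<open>1 - \<eta> t * c\<close>.\<close>
  have \<eta>: "\<eta> t = (1 - \<eta> t * c) * \<eta> n"
    using rec n by simp
  have "x (t + 1) w = - (\<eta> t *\<^sub>R (S + (grad f (x t w) + \<xi> t w)))"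
    using iterate_Suc[OF t w] by (simp add: n S_def)
  also have "\<dots> = - (\<eta> t *\<^sub>R S) - \<eta> t *\<^sub>R (grad f (x t w) + \<xi> t w)"
    by (simp add: scaleR_add_right)
  also have "\<eta> t *\<^sub>R S = (1 - \<eta> t * c) *\<^sub>R (\<eta> n *\<^sub>R S)"
    by (subst \<eta>) simp
  also have "- ((1 - \<eta> t * c) *\<^sub>R (\<eta> n *\<^sub>R S)) = (1 - \<eta> t * c) *\<^sub>R x t w"
    by (simp add: x)
  finally show ?thesis
    by (simp add: scaleR_add_right scaleR_diff_left)
qed

text \<open>The pointwise descent bound is integrated. Its cross term vanishes because the
  regularized gradient depends only on the past, and the growth condition replaces the noise
  variance: the \<rho> part enters \<open>S\<close>, the constant \<sigma> part stays
  outside.\<close>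

lemma expected_step:
  fixes \<mu> e :: real
  assumes t: "1 \<le> t" and coeff: "0 \<le> (L + \<mu>) / 2 * e\<^sup>2"
    and step: "\<And>w. w \<in> space M \<Longrightarrow>
      x (t + 1) w = x t w - e *\<^sub>R ((grad f (x t w) + \<mu> *\<^sub>R x t w) + \<xi> t w)"
  defines "S w \<equiv> - e * (norm (grad f (x t w) + \<mu> *\<^sub>R x t w))\<^sup>2
    + (L + \<mu>) / 2 * e\<^sup>2 * ((norm (grad f (x t w) + \<mu> *\<^sub>R x t w))\<^sup>2 + \<rho> * (norm (grad f (x t w)))\<^sup>2)"
  shows "integrable M S"
    and "(\<integral>w. f (x (t + 1) w) + \<mu> / 2 * (norm (x (t + 1) w))\<^sup>2 \<partial>M)
      \<le> (\<integral>w. f (x t w) + \<mu> / 2 * (norm (x t w))\<^sup>2 + S w \<partial>M) + (L + \<mu>) / 2 * e\<^sup>2 * \<sigma>\<^sup>2"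
proof -
  define z where "z w = grad f (x t w) + \<mu> *\<^sub>R x t w" for w
  define c where "c = (L + \<mu>) / 2 * e\<^sup>2"
  have x: "square_integrable M (x t)" "square_integrable M (x (Suc t))"
    using t by (auto intro: iterate_square_integrable)
  have a: "square_integrable M (\<lambda>w. grad f (x t w))"
    using x(1) by (rule grad_square_integrable)
  have z: "square_integrable M z"
    unfolding z_def by (intro square_integrable_add a square_integrable_scaleR x)
  have \<xi>: "square_integrable M (\<xi> t)"
    using t x(1) by (rule noise_second_moment)
  have [measurable]: "x t \<in> borel_measurable (\<F> t)"
    using t measurable_iterate_noise by blast
  have "z \<in> borel_measurable (\<F> t)"
    unfolding z_def by measurable
  then have orth: "(\<integral>w. \<xi> t w \<bullet> z w \<partial>M) = 0"
    using t z by (intro noise_orthogonal)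
  note int [simp] = square_integrableD(2)[OF x(1)] square_integrableD(2)[OF x(2)]
    square_integrableD(2)[OF a] square_integrableD(2)[OF z] square_integrableD(2)[OF \<xi>]
    f_integrable[OF x(1)] f_integrable[OF x(2)] integrable_inner[OF \<xi> z]
  have S: "S w = - e * (norm (z w))\<^sup>2 + c * ((norm (z w))\<^sup>2 + \<rho> * (norm (grad f (x t w)))\<^sup>2)" for w
    by (simp add: S_def z_def c_def)
  then show S_int: "integrable M S"
    by (subst Bochner_Integration.integrable_cong[OF refl S]) simp
  \<comment> \<open>\<open>U\<close> is the noise-free part of the descent bound.\<close>
  define U where "U w = f (x t w) + \<mu> / 2 * (norm (x t w))\<^sup>2 - e * (norm (z w))\<^sup>2
    + c * (norm (z w))\<^sup>2" for w
  have U [simp]: "integrable M U"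
    unfolding U_def by simp
  have "(\<integral>w. f (x (t + 1) w) + \<mu> / 2 * (norm (x (t + 1) w))\<^sup>2 \<partial>M)
    \<le> (\<integral>w. U w + c * (norm (\<xi> t w))\<^sup>2 + ((L + \<mu>) * e\<^sup>2 - e) * (\<xi> t w \<bullet> z w) \<partial>M)"
  proof (rule integral_mono)
    fix w assume "w \<in> space M"
    then show "f (x (t + 1) w) + \<mu> / 2 * (norm (x (t + 1) w))\<^sup>2
      \<le> U w + c * (norm (\<xi> t w))\<^sup>2 + ((L + \<mu>) * e\<^sup>2 - e) * (\<xi> t w \<bullet> z w)"
      using L_smooth_descent[OF smooth, of "x t w" e \<mu> "\<xi> t w"]
      unfolding step[OF \<open>w \<in> space M\<close>] z_def[symmetric] c_def[symmetric] U_def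
      by (simp only: distrib_left add_ac)
  qed simp_all
  also have "\<dots> = (\<integral>w. U w \<partial>M) + c * (\<integral>w. (norm (\<xi> t w))\<^sup>2 \<partial>M)"
    by (simp add: orth)
  also have "\<dots> \<le> (\<integral>w. U w \<partial>M) + c * (\<rho> * (\<integral>w. (norm (grad f (x t w)))\<^sup>2 \<partial>M) + \<sigma>\<^sup>2)"
    using noise_second_moment(2)[OF t x(1)] coeff
    by (intro add_left_mono mult_left_mono) (auto simp: c_def)
  also have "\<dots> = (\<integral>w. U w + c * \<rho> * (norm (grad f (x t w)))\<^sup>2 \<partial>M) + c * \<sigma>\<^sup>2"
    by (simp add: distrib_left)
  also have "(\<lambda>w. U w + c * \<rho> * (norm (grad f (x t w)))\<^sup>2)
    = (\<lambda>w. f (x t w) + \<mu> / 2 * (norm (x t w))\<^sup>2 + S w)"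
    by (rule ext) (simp add: S U_def distrib_left)
  finally show "(\<integral>w. f (x (t + 1) w) + \<mu> / 2 * (norm (x (t + 1) w))\<^sup>2 \<partial>M)
      \<le> (\<integral>w. f (x t w) + \<mu> / 2 * (norm (x t w))\<^sup>2 + S w \<partial>M) + (L + \<mu>) / 2 * e\<^sup>2 * \<sigma>\<^sup>2"
    by (simp only: c_def)
qed

end

section \<open>The explicit step sizes and the telescoped bound\<close>

theorem theorem4p3:
  fixes f :: "real ^ 'd \<Rightarrow> real"
    and M :: "'w measure"
    and G :: "nat \<Rightarrow> real ^ 'd \<Rightarrow> 'w \<Rightarrow> real ^ 'd"
    and x :: "nat \<Rightarrow> 'w \<Rightarrow> real ^ 'd"
    and \<eta> :: "nat \<Rightarrow> real"
    and L \<rho> \<sigma> \<alpha> \<Delta> :: real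
    and T :: nat
  assumes "L > 0" and "L_smooth L f" and "bdd_below (range f)"
    and "\<rho> \<ge> 0" and "\<sigma> \<ge> 0"
    and "prob_space M"
    and "stochastic_oracle M G"
    and "unbiased_oracle M f G"
    and "strong_growth_oracle M \<rho> \<sigma> f G"
    and "\<alpha> = min (\<sigma> / (L * (1 + \<rho>))) 1"
    and "\<And>t. t \<ge> 1 \<Longrightarrow> \<eta> t = 1 / (L * (1 + \<rho>) * (1 + \<rho> + \<alpha> * sqrt (real t)))"
    and "sda_iterates M \<eta> G x"
    and "conditionally_unbiased M f G x"
    and "conditional_strong_growth M \<rho> \<sigma> f G x"
    and "\<Delta> = f 0 - (INF y. f y)"
    and "T \<ge> 1"
  shows "(\<forall>t\<in>{1..T}. integrable M (\<lambda>w. (norm (grad f (x t w)))\<^sup>2)) \<and>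
    1 / real T * (\<Sum>t=1..T. \<integral>w. (norm (grad f (x t w)))\<^sup>2 \<partial>M)
      \<le> (10 * \<Delta> + 4 * (\<sigma>\<^sup>2 / (L * (1 + \<rho>)) + L * (1 + \<rho>)) * ln (1 + \<alpha> * sqrt (real T)))
         * ((L * (1 + \<rho>)\<^sup>2 + \<sigma> * sqrt (real T)) / real T)"
proof -
  interpret prob_space M by fact
  interpret sda_process M f G x \<eta> L \<rho> \<sigma>
    by unfold_locales fact+
  define r K where "r = 1 + \<rho>" and "K = L * r"
  define u where "u t = \<alpha> * sqrt (real t)" for t :: nat
  \<comment> \<open>The subtraction is real and \<open>sqrt (- 1) = - 1\<close>, so
    \<open>l 0 = \<alpha>\<close>. This value only ever multiplies the squared norm of
    \<open>x 1 = 0\<close>.\<close>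
  define l where "l t = \<alpha> * (sqrt (real t) - sqrt (real t - 1))" for t :: nat
  define \<Lambda> where "\<Lambda> t = K * l t" for t
  define C where "C = \<sigma>\<^sup>2 / K + K"
  define E where "E t = (\<integral>w. (norm (grad f (x t w)))\<^sup>2 \<partial>M)" for t
  \<comment> \<open>The weight carries the index \<open>t - 1\<close> of the previous step, so that
    passing to \<open>\<Lambda> t\<close> releases the decrease
    \<open>\<Lambda> (t - 1) - \<Lambda> t\<close> within step \<open>t\<close>.\<close>
  define \<Phi> where "\<Phi> t = (\<integral>w. f (x t w) + \<Lambda> (t - 1) / 2 * (norm (x t w))\<^sup>2 \<partial>M)" for t
  have r: "1 \<le> r" and K: "0 < K" and L: "L = K / r" and rho_eq: "\<rho> = r - 1"
    using assms(1,4) by (simp_all add: r_def K_def)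
  have \<alpha>: "\<alpha> = min (\<sigma> / K) 1"
    using assms(10) by (simp add: K_def r_def)
  then have \<alpha>01: "0 \<le> \<alpha>" "\<alpha> \<le> 1"
    using K assms(5) by auto
  have u0: "0 \<le> u t" for t
    using \<alpha>01 by (simp add: u_def)
  have \<eta>: "\<eta> t = 1 / (K * (r + u t))" if "1 \<le> t" for t
    using assms(11)[OF that] by (simp add: K_def r_def u_def)
  have \<eta>_inverse: "\<eta> t * (K * (r + u t)) = 1" if "1 \<le> t" for t
    using \<eta>[OF that] K r u0[of t] by simp
  have l_eq: "l t = u t - u (t - 1)" if "1 \<le> t" for t
    using that by (simp add: l_def u_def right_diff_distrib of_nat_diff)
  have l0: "0 \<le> l t" for t
    using \<alpha>01 by (simp add: l_def)
  have x2: "square_integrable M (x t)" if "1 \<le> t" for t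
    using that by (rule iterate_square_integrable)
  have grad_int [simp]: "integrable M (\<lambda>w. (norm (grad f (x t w)))\<^sup>2)" if "1 \<le> t" for t
    using square_integrableD(2)[OF grad_square_integrable[OF x2[OF that]]] .

  have pointwise: "- \<eta> t * (norm (a + \<Lambda> t *\<^sub>R y))\<^sup>2
      + (L + \<Lambda> t) / 2 * (\<eta> t)\<^sup>2 * ((norm (a + \<Lambda> t *\<^sub>R y))\<^sup>2 + \<rho> * (norm a)\<^sup>2)
      + (\<Lambda> t - \<Lambda> (t - 1)) / 2 * (norm y)\<^sup>2 \<le> - (\<eta> t / 4) * (norm a)\<^sup>2"
    if t: "1 \<le> t" and y: "t = 1 \<longrightarrow> y = 0" for t and a y :: "real ^ 'd"
  proof (cases "t = 1")
    case True
    then show ?thesis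
      using first_step_decrease[OF K r \<alpha>01 L, of "\<Lambda> 1" "\<eta> 1" a] \<eta>[of 1] y
      by (simp add: \<Lambda>_def l_def u_def rho_eq)
  next
    case False
    then have t2: "2 \<le> t"
      using t by simp
    define d where "d = sqrt (real t) - sqrt (real t - 1)"
    have d: "0 \<le> d" "d \<le> 1 / 2" "3 * d \<le> sqrt (real t)" "d * sqrt (real t) \<le> 1"
      using sqrt_diff_bounds[OF t2] by (simp_all add: d_def)
    have ld: "l t = \<alpha> * d"
      by (simp add: l_def d_def)
    have l_half: "l t \<le> 1 / 2"
      using mult_mono[OF \<alpha>01(2) d(2)] d(1) by (simp add: ld)
    have l3: "3 * l t \<le> u t"
      using mult_left_mono[OF d(3) \<alpha>01(1)] by (simp add: ld u_def mult_ac)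
    have "\<alpha> * \<alpha> \<le> 1"
      using \<alpha>01 by (intro mult_le_one)
    then have "\<alpha> * \<alpha> * (d * sqrt (real t)) \<le> 1 * 1"
      using d(4) by (rule mult_mono) (use d(1) in auto)
    then have lu: "l t * u t \<le> 1"
      by (simp add: ld u_def mult_ac)
    have prev: "l (t - 1) = \<alpha> * (sqrt (real t - 1) - sqrt (real t - 2))"
      using t2 by (simp add: l_def of_nat_diff)
    have dec: "(l t)\<^sup>2 \<le> u t * (l (t - 1) - l t)"
    proof -
      have "\<alpha>\<^sup>2 * d\<^sup>2 \<le> \<alpha>\<^sup>2 * (sqrt (real t) * ((sqrt (real t - 1) - sqrt (real t - 2)) - d))"
        using sqrt_diff_decrease[OF t2] by (intro mult_left_mono) (simp_all add: d_def)
      then show ?thesis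
        unfolding prev ld u_def
        by (simp add: power_mult_distrib power2_eq_square right_diff_distrib mult_ac)
    qed
    \<comment> \<open>For positive \<alpha> the sign is read off from \<open>dec\<close>, whose left
      side is a square and whose factor \<open>u t\<close> is positive.\<close>
    have "0 \<le> l (t - 1) - l t"
    proof (cases "\<alpha> = 0")
      case True
      then show ?thesis
        by (simp add: l_def)
    next
      case False
      then have "0 < u t"
        using \<alpha>01 t by (simp add: u_def)
      then show ?thesis
        using order_trans[OF zero_le_power2 dec] by (simp add: zero_le_mult_iff)
    qed
    then have D0: "0 \<le> \<Lambda> (t - 1) - \<Lambda> t"
      using K by (simp add: \<Lambda>_def)
    have "K * (l t)\<^sup>2 \<le> K * (u t * (l (t - 1) - l t))"
      using K dec by (intro mult_left_mono) auto
    also have "\<dots> = u t * (\<Lambda> (t - 1) - \<Lambda> t)"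
      by (simp add: \<Lambda>_def right_diff_distrib)
    finally have D: "K * (l t)\<^sup>2 \<le> u t * (\<Lambda> (t - 1) - \<Lambda> t)" .
    have "(\<Lambda> t - \<Lambda> (t - 1)) / 2 * (norm y)\<^sup>2 = - ((\<Lambda> (t - 1) - \<Lambda> t) / 2 * (norm y)\<^sup>2)"
      by (simp add: left_diff_distrib diff_divide_distrib)
    with regularized_step_decrease[OF K r l0 l_half l3 lu D D0 L \<Lambda>_def \<eta>[OF t], of a y]
    show ?thesis
      by (simp only: rho_eq add_uminus_conv_diff)
  qed

  have step: "\<Phi> (t + 1) \<le> \<Phi> t - \<eta> t / 4 * E t + C * (ln (1 + u t) - ln (1 + u (t - 1)))"
    if t: "1 \<le> t" for t
  proof -
    define S where "S w = - \<eta> t * (norm (grad f (x t w) + \<Lambda> t *\<^sub>R x t w))\<^sup>2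
      + (L + \<Lambda> t) / 2 * (\<eta> t)\<^sup>2
        * ((norm (grad f (x t w) + \<Lambda> t *\<^sub>R x t w))\<^sup>2 + \<rho> * (norm (grad f (x t w)))\<^sup>2)" for w
    have coeff: "0 \<le> (L + \<Lambda> t) / 2 * (\<eta> t)\<^sup>2"
      using assms(1) K l0[of t] by (simp add: \<Lambda>_def)
    \<comment> \<open>Division-free form of the identity that \<open>\<Lambda> t\<close> is the
      increment of \<open>1 / \<eta>\<close>, where
      \<open>1 / \<eta> t = K * (r + u t)\<close>.\<close>
    have rec: "\<eta> t = (1 - \<eta> t * \<Lambda> t) * \<eta> (t - 1)" if "2 \<le> t"
    proof -
      have "\<Lambda> t = K * u t - K * u (t - 1)"
        by (simp only: \<Lambda>_def l_eq[OF t] right_diff_distrib)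
      then have "K * (r + u t) - \<Lambda> t = K * (r + u (t - 1))"
        by (simp add: distrib_left)
      moreover have "1 - \<eta> t * \<Lambda> t = \<eta> t * (K * (r + u t) - \<Lambda> t)"
        using \<eta>_inverse[OF t] by (simp only: right_diff_distrib)
      moreover have "K * (r + u (t - 1)) * \<eta> (t - 1) = 1"
        using \<eta>_inverse[of "t - 1"] that by (simp add: mult_ac)
      ultimately show ?thesis
        by (simp add: mult.assoc)
    qed
    note exp_step = expected_step[OF t coeff iterate_regularized_step[OF t _ rec], folded S_def]
    note [simp] = square_integrableD(2)[OF x2[OF t]] f_integrable[OF x2[OF t]]
      exp_step(1) grad_int[OF t]
    have "\<Phi> (t + 1) \<le> (\<integral>w. f (x t w) + \<Lambda> t / 2 * (norm (x t w))\<^sup>2 + S w \<partial>M)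
        + (L + \<Lambda> t) / 2 * (\<eta> t)\<^sup>2 * \<sigma>\<^sup>2"
      unfolding \<Phi>_def using exp_step(2) by simp
    \<comment> \<open>Here the weight returns from \<open>\<Lambda> t\<close> to
      \<open>\<Lambda> (t - 1)\<close>, and \<open>pointwise\<close> spends the difference on the
      gradient of the regularizer.\<close>
    also have "(\<integral>w. f (x t w) + \<Lambda> t / 2 * (norm (x t w))\<^sup>2 + S w \<partial>M)
      \<le> (\<integral>w. f (x t w) + \<Lambda> (t - 1) / 2 * (norm (x t w))\<^sup>2
            - \<eta> t / 4 * (norm (grad f (x t w)))\<^sup>2 \<partial>M)"
    proof (rule integral_mono)
      fix w assume "w \<in> space M"
      then have "t = 1 \<longrightarrow> x t w = 0"
        using iterate_1 by blast
      from pointwise[OF t this, of "grad f (x t w)", folded S_def]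
      show "f (x t w) + \<Lambda> t / 2 * (norm (x t w))\<^sup>2 + S w
        \<le> f (x t w) + \<Lambda> (t - 1) / 2 * (norm (x t w))\<^sup>2 - \<eta> t / 4 * (norm (grad f (x t w)))\<^sup>2"
        by (simp add: left_diff_distrib diff_divide_distrib)
    qed simp_all
    also have "\<dots> = \<Phi> t - \<eta> t / 4 * E t"
      by (simp add: \<Phi>_def E_def)
    also have "(L + \<Lambda> t) / 2 * (\<eta> t)\<^sup>2 * \<sigma>\<^sup>2 \<le> C * (ln (1 + u t) - ln (1 + u (t - 1)))"
    proof -
      have "(u t)\<^sup>2 - (u (t - 1))\<^sup>2 = \<alpha>\<^sup>2"
        using t by (simp add: u_def power_mult_distrib right_diff_distrib of_nat_diff)
      moreover have "u (t - 1) \<le> u t"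
        using l0[of t] l_eq[OF t] by simp
      ultimately show ?thesis
        using noise_term_le[OF K r assms(5) \<alpha> u0[of "t - 1"], of "u t"]
        by (simp only: C_def L[symmetric] \<Lambda>_def l_eq[OF t] \<eta>[OF t])
    qed
    finally show ?thesis
      by simp
  qed

  \<comment> \<open>The logarithms collapse to \<open>ln (1 + u n)\<close> because
    \<open>u 0 = 0\<close>.\<close>
  have telescope: "\<Phi> (n + 1) + (\<Sum>t=1..n. \<eta> t / 4 * E t) \<le> \<Phi> 1 + C * ln (1 + u n)" for n
  proof (induction n)
    case 0
    show ?case
      by (simp add: u_def)
  next
    case (Suc n)
    have "C * (ln (1 + u (Suc n)) - ln (1 + u n)) = C * ln (1 + u (Suc n)) - C * ln (1 + u n)"
      by (rule right_diff_distrib)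
    with Suc step[of "Suc n"] show ?case
      by simp
  qed
  have "\<Phi> 1 = (\<integral>w. f 0 \<partial>M)"
    unfolding \<Phi>_def using iterate_1 by (intro Bochner_Integration.integral_cong) auto
  then have \<Phi>1: "\<Phi> 1 = f 0"
    by (simp add: prob_space)
  have \<Phi>_ge: "(INF y. f y) \<le> \<Phi> (T + 1)"
  proof -
    have "(\<integral>w. (INF y. f y) \<partial>M) \<le> \<Phi> (T + 1)"
      unfolding \<Phi>_def
    proof (rule integral_mono)
      fix w
      have "(INF y. f y) \<le> f (x (T + 1) w)"
        using assms(3) by (intro cINF_lower) auto
      moreover have "0 \<le> \<Lambda> (T + 1 - 1) / 2 * (norm (x (T + 1) w))\<^sup>2"
        using K l0 by (simp add: \<Lambda>_def)
      ultimately show "(INF y. f y) \<le> f (x (T + 1) w) + \<Lambda> (T + 1 - 1) / 2 * (norm (x (T + 1) w))\<^sup>2"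
        by linarith
    qed (use square_integrableD(2)[OF x2[of "Suc T"]] f_integrable[OF x2[of "Suc T"]] in auto)
    then show ?thesis
      by (simp add: prob_space)
  qed
  have \<Delta>0: "0 \<le> \<Delta>"
    using assms(3) by (auto simp: assms(15) intro: cINF_lower)
  have E0: "0 \<le> E t" for t
    by (simp add: E_def)
  \<comment> \<open>The step sizes decrease, so the last one can be pulled out of the weighted
    sum.\<close>
  have "\<eta> T * (\<Sum>t=1..T. E t) = (\<Sum>t=1..T. \<eta> T * E t)"
    by (rule sum_distrib_left)
  also have "\<dots> \<le> (\<Sum>t=1..T. \<eta> t * E t)"
  proof (intro sum_mono mult_right_mono E0)
    fix t assume t: "t \<in> {1..T}"
    then have "u t \<le> u T"
      using \<alpha>01 by (auto simp: u_def intro: mult_left_mono)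
    then have "K * (r + u t) \<le> K * (r + u T)" "0 < K * (r + u t)"
      using K r u0[of t] by auto
    then show "\<eta> T \<le> \<eta> t"
      using \<eta>[of t] \<eta>[of T] t by (auto intro: divide_left_mono frac_le)
  qed
  also have "\<dots> = 4 * (\<Sum>t=1..T. \<eta> t / 4 * E t)"
    by (simp add: sum_distrib_left)
  also have "\<dots> \<le> 4 * (\<Delta> + C * ln (1 + u T))"
    using telescope[of T] \<Phi>1 \<Phi>_ge by (simp add: assms(15))
  \<comment> \<open>The argument gives the factor 4, from \<open>\<eta> t / 4\<close>, on both
    terms; since \<Delta> is nonnegative, 10 is a weakening.\<close>
  also have "\<dots> \<le> 10 * \<Delta> + 4 * C * ln (1 + u T)"
    using \<Delta>0 by simp
  finally have main: "\<eta> T * (\<Sum>t=1..T. E t) \<le> 10 * \<Delta> + 4 * C * ln (1 + u T)" .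
  define R where "R = 10 * \<Delta> + 4 * C * ln (1 + u T)"
  have "(\<Sum>t=1..T. E t) \<le> R * (K * (r + u T))"
    using main K r u0[of T] \<eta>[OF assms(16)] by (simp add: R_def pos_divide_le_eq)
  also have "\<dots> \<le> R * (L * r\<^sup>2 + \<sigma> * sqrt (real T))"
  proof (rule mult_left_mono)
    \<comment> \<open>This is the branch \<open>\<sigma> / K\<close> of the minimum defining
      \<alpha>; together with \<open>K * r = L * r\<^sup>2\<close> it turns
      \<open>1 / \<eta> T\<close> into the stated numerator.\<close>
    have "\<alpha> * K \<le> \<sigma>"
      using K by (simp add: \<alpha> min_def pos_le_divide_eq)
    then have "\<alpha> * K * sqrt (real T) \<le> \<sigma> * sqrt (real T)"
      by (intro mult_right_mono) auto
    then show "K * (r + u T) \<le> L * r\<^sup>2 + \<sigma> * sqrt (real T)"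
      by (simp add: K_def u_def power2_eq_square algebra_simps)
    show "0 \<le> R"
      using \<Delta>0 K u0[of T] by (simp add: R_def C_def)
  qed
  finally have "(\<Sum>t=1..T. E t) / real T \<le> R * (L * r\<^sup>2 + \<sigma> * sqrt (real T)) / real T"
    by (rule divide_right_mono) simp
  then show ?thesis
    by (simp add: R_def C_def E_def K_def r_def u_def)
qed

end
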